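(* Let $K$ be a field and let $I$ and $J$ be normally torsion-free square-free monomial ideals in $R=K[x_1,\ldots,x_n]$ satisfying the following: (i) $J$ is a proper demotion of $I$; (ii) if $\mathfrak{q}\in \mathrm{Ass}(R/J)\setminus \mathrm{Ass}(R/I)$, then $\mathfrak{q}\nsubseteq \mathfrak{p}$ for every $\mathfrak{p}\in \mathrm{Ass}(R/I)$. Then, for all integers $r,s\geq 1$, the ideal $I^rJ^s$ is normally torsion-free.
   Context: Let $J\subseteq I$ be ideals in a commutative Noetherian ring $R$. $J$ is a demotion of $I$ if $I^rJ^s=I^{r+s}\cap J^s$ for all integers $r,s\geq 0$ (with $I^0=J^0=R$); it is a proper demotion of $I$ if moreover $J\neq I$. An ideal $I$ of a Noetherian ring $R$ is normally torsion-free if $\mathrm{Ass}_R(R/I^s)\subseteq \mathrm{Ass}_R(R/I)$ for all $s\geq 1$. A monomial ideal is square-free if it is generated by square-free monomials. *)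

theory Defs
  imports
    "HOL-Library.Poly_Mapping"
    "HOL-Algebra.Ideal_Product"
    "HOL-Algebra.QuotRing"
    "HOL-Algebra.Module"
    "HOL-Algebra.Algebraic_Closure_Type"
begin

text \<open>
  The polynomial ring over the field \<open>'k\<close> in finitely many variables indexed by \<open>'n\<close>.
  An exponent vector is an element of \<^typ>\<open>'n \<Rightarrow>\<^sub>0 nat\<close>; the product of
  \<^typ>\<open>('n \<Rightarrow>\<^sub>0 nat) \<Rightarrow>\<^sub>0 'k\<close> is convolution, i.e. multiplication of polynomials.
\<close>

definition polynomial_ring :: "(('n::finite \<Rightarrow>\<^sub>0 nat) \<Rightarrow>\<^sub>0 'k::field) ring"
  where "polynomial_ring = ring_of_type_algebra"

definition monomial :: "('n \<Rightarrow>\<^sub>0 nat) \<Rightarrow> (('n \<Rightarrow>\<^sub>0 nat) \<Rightarrow>\<^sub>0 'k::field)"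
  where "monomial m = Poly_Mapping.single m 1"

definition squarefree_exponent :: "('n \<Rightarrow>\<^sub>0 nat) \<Rightarrow> bool"
  where "squarefree_exponent m \<longleftrightarrow> (\<forall>i. Poly_Mapping.lookup m i \<le> 1)"

definition squarefree_monomial_ideal :: "(('n::finite \<Rightarrow>\<^sub>0 nat) \<Rightarrow>\<^sub>0 'k::field) set \<Rightarrow> bool"
  where "squarefree_monomial_ideal I \<longleftrightarrow>
    (\<exists>M. (\<forall>m\<in>M. squarefree_exponent m) \<and> I = Idl\<^bsub>polynomial_ring\<^esub> (monomial ` M))"

text \<open>
  Powers of ideals are powers in the monoid \<^const>\<open>ideals_set\<close>, whose unit is the whole ring,
  so that the zeroth power of any ideal is the whole ring.
\<close>

definition ideal_power :: "('a, 'm) ring_scheme \<Rightarrow> 'a set \<Rightarrow> nat \<Rightarrow> 'a set"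
  where "ideal_power R I r = I [^]\<^bsub>ideals_set R\<^esub> r"

text \<open>
  The quotient \<open>R/I\<close> as an \<open>R\<close>-module. The record type \<^type>\<open>module\<close> extends rings, so the
  (irrelevant) multiplicative fields are those of the quotient ring.
\<close>

definition quotient_module :: "('a, 'm) ring_scheme \<Rightarrow> 'a set \<Rightarrow> ('a, 'a set) module"
  where "quotient_module R I =
    \<lparr>carrier = carrier (R Quot I), monoid.mult = monoid.mult (R Quot I), one = one (R Quot I),
     zero = zero (R Quot I), add = add (R Quot I),
     module.smult = (\<lambda>r A. (I +>\<^bsub>R\<^esub> r) \<otimes>\<^bsub>R Quot I\<^esub> A)\<rparr>"

lemma quotient_module_is_module:
  assumes "cring R" "ideal I R"
  shows "module R (quotient_module R I)"
proof -
  interpret R: cring R by fact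
  interpret I: ideal I R by fact
  interpret Q: cring "R Quot I"
    by (rule I.quotient_is_cring) fact
  interpret h: ring_hom_cring R "R Quot I" "(+>\<^bsub>R\<^esub>) I"
    by (rule I.rcos_ring_hom_cring) fact
  have "abelian_group (quotient_module R I)"
    unfolding quotient_module_def
    by (rule abelian_groupI) (auto simp: Q.a_ac intro: Q.l_neg Q.a_inv_closed)
  then show ?thesis
    by (intro moduleI)
      (simp_all add: assms(1) quotient_module_def Q.l_distr Q.r_distr Q.m_assoc)
qed

definition associated_primes ::
    "('a, 'm) ring_scheme \<Rightarrow> ('a, 'b, 'c) module_scheme \<Rightarrow> 'a set set"
  where "associated_primes R M =
    {P. primeideal P R \<and> (\<exists>x\<in>carrier M. P = {r \<in> carrier R. r \<odot>\<^bsub>M\<^esub> x = \<zero>\<^bsub>M\<^esub>})}"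

definition normally_torsion_free :: "('a, 'm) ring_scheme \<Rightarrow> 'a set \<Rightarrow> bool"
  where "normally_torsion_free R I \<longleftrightarrow> ideal I R \<and>
    (\<forall>s\<ge>1. associated_primes R (quotient_module R (ideal_power R I s))
            \<subseteq> associated_primes R (quotient_module R I))"

definition demotion :: "('a, 'm) ring_scheme \<Rightarrow> 'a set \<Rightarrow> 'a set \<Rightarrow> bool"
  where "demotion R J I \<longleftrightarrow> ideal I R \<and> ideal J R \<and> J \<subseteq> I \<and>
    (\<forall>r s. ideal_power R I r \<cdot>\<^bsub>R\<^esub> ideal_power R J s
            = ideal_power R I (r + s) \<inter> ideal_power R J s)"

definition proper_demotion :: "('a, 'm) ring_scheme \<Rightarrow> 'a set \<Rightarrow> 'a set \<Rightarrow> bool"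
  where "proper_demotion R J I \<longleftrightarrow> demotion R J I \<and> J \<noteq> I"

end

theory Submission
  imports Defs
begin

text \<open>
  Put \<open>K = I\<^sup>r J\<^sup>s\<close>. Since \<open>J\<close> is a demotion of \<open>I\<close>, every power
  \<open>K\<^sup>t = I\<^sup>r\<^sup>t J\<^sup>s\<^sup>t\<close> is the intersection of a power of \<open>I\<close> with a power of \<open>J\<close>. An associated
  prime of an intersection is associated to one of the two ideals, and \<open>I\<close> and \<open>J\<close> are normally
  torsion-free, so \<open>Ass(R/K\<^sup>t) \<subseteq> Ass(R/I) \<union> Ass(R/J)\<close>. It remains to put this union into
  \<open>Ass(R/K)\<close>, in two steps.

  \<^item> \<open>Ass(R/I) \<subseteq> Ass(R/J)\<close>. A prime \<open>P\<close> in \<open>Ass(R/I)\<close> contains \<open>J\<close> and hence some \<open>Q\<close> in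
    \<open>Ass(R/J)\<close>. The separation hypothesis forces \<open>Q\<close> into \<open>Ass(R/I)\<close>, and the associated primes
    of the radical ideal \<open>I\<close> are pairwise incomparable, so \<open>P = Q\<close>.

  \<^item> \<open>Ass(R/J) \<subseteq> Ass(R/K)\<close>. As \<open>J\<^sup>r\<^sup>+\<^sup>s \<subseteq> K \<subseteq> J\<close>, the ideals \<open>J\<close> and \<open>K\<close> have the same radical.
    An associated prime of the radical ideal \<open>J\<close> is minimal over \<open>J\<close>, hence over \<open>K\<close>, and a minimal
    prime of \<open>K\<close> is associated to \<open>R/K\<close>. The proof of \<open>associated_primes_between_power\<close> makes this
    explicit, starting from a finite set of generators of \<open>J\<close>.

  These steps hold over any commutative ring in which \<open>I\<close> and \<open>J\<close> are radical, \<open>J\<close> is finitely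
  generated and every prime over \<open>J\<close> contains an associated prime of \<open>R/J\<close>
  (\<open>normally_torsion_free_demotion_prod\<close>). For square-free monomial ideals these properties are
  combinatorial. Regard the generators as edges of a hypergraph on the variables: a vertex cover
  \<open>S\<close> yields the prime ideal generated by the variables in \<open>S\<close>, the ideal is the intersection of
  these primes (\<open>radical_ideal_squarefree\<close>), and the primes of minimal covers are associated
  (\<open>minimal_cover_associated\<close>).
\<close>

section \<open>Associated primes of ideals in commutative rings\<close>

definition colon :: "('a, 'm) ring_scheme \<Rightarrow> 'a set \<Rightarrow> 'a \<Rightarrow> 'a set"
  where "colon R A y = {u \<in> carrier R. u \<otimes>\<^bsub>R\<^esub> y \<in> A}"

text \<open>
  Stability under square roots suffices: if \<open>x\<^sup>n \<in> A\<close> with \<open>n \<ge> 1\<close>, then \<open>x\<close> to the power \<open>2\<^sup>k\<close> lies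
  in \<open>A\<close> for large \<open>k\<close>, and \<open>k\<close> square roots lead back to \<open>x\<close>.
\<close>

definition radical_ideal :: "('a, 'm) ring_scheme \<Rightarrow> 'a set \<Rightarrow> bool"
  where "radical_ideal R A \<longleftrightarrow> ideal A R \<and> (\<forall>x\<in>carrier R. x \<otimes>\<^bsub>R\<^esub> x \<in> A \<longrightarrow> x \<in> A)"

lemma (in cring) subset_colon:
  assumes "ideal A R" "y \<in> carrier R"
  shows "A \<subseteq> colon R A y"
proof
  fix u assume "u \<in> A"
  then show "u \<in> colon R A y"
    using ideal.I_r_closed[OF assms(1) _ assms(2)] ideal.Icarr[OF assms(1)] by (simp add: colon_def)
qed

lemma (in cring) associated_primes_quotient_iff:
  assumes A: "ideal A R"
  shows "P \<in> associated_primes R (quotient_module R A) \<longleftrightarrow>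
    primeideal P R \<and> (\<exists>y\<in>carrier R. P = colon R A y)"
proof -
  interpret A: ideal A R by fact
  have "(A +> u) \<otimes>\<^bsub>R Quot A\<^esub> (A +> y) = \<zero>\<^bsub>R Quot A\<^esub> \<longleftrightarrow> u \<otimes> y \<in> A"
    if "u \<in> carrier R" "y \<in> carrier R" for u y
    using that A.rcos_const_imp_mem[of "u \<otimes> y"] a_rcos_zero[OF A, of "u \<otimes> y"]
    by (auto simp: FactRing_def A.rcoset_mult_add)
  then have "{u \<in> carrier R. (A +> u) \<otimes>\<^bsub>R Quot A\<^esub> (A +> y) = \<zero>\<^bsub>R Quot A\<^esub>} = colon R A y"
    if "y \<in> carrier R" for y
    using that by (auto simp: colon_def)
  then show ?thesis
    by (auto simp: associated_primes_def quotient_module_def FactRing_def A_RCOSETS_def')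
qed

text \<open>
  The colon ideal of an intersection is the intersection of the two colon ideals, and a prime ideal
  that is an intersection of two ideals is equal to one of them.
\<close>

lemma (in cring) associated_primes_inter_subset:
  assumes A: "ideal A R" and B: "ideal B R"
  shows "associated_primes R (quotient_module R (A \<inter> B)) \<subseteq>
    associated_primes R (quotient_module R A) \<union> associated_primes R (quotient_module R B)"
proof
  interpret A: ideal A R by fact
  interpret B: ideal B R by fact
  fix P assume "P \<in> associated_primes R (quotient_module R (A \<inter> B))"
  then obtain y where P: "primeideal P R" and y: "y \<in> carrier R" and eq: "P = colon R (A \<inter> B) y"
    using associated_primes_quotient_iff[OF i_intersect[OF A B]] by blast
  have "colon R A y \<subseteq> P \<or> colon R B y \<subseteq> P"
  proof (rule ccontr)
    assume "\<not> ?thesis"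
    then obtain u v where u: "u \<in> colon R A y" "u \<notin> P" and v: "v \<in> colon R B y" "v \<notin> P" by blast
    then have uv: "u \<in> carrier R" "v \<in> carrier R" by (auto simp: colon_def)
    have "v \<otimes> (u \<otimes> y) \<in> A" "u \<otimes> (v \<otimes> y) \<in> B"
      using u v uv by (auto simp: colon_def intro: A.I_l_closed B.I_l_closed)
    then have "u \<otimes> v \<in> P"
      using uv y by (simp add: eq colon_def m_ac)
    then show False
      using primeideal.I_prime[OF P, of u v] u v uv by blast
  qed
  moreover have "P \<subseteq> colon R A y" "P \<subseteq> colon R B y"
    by (auto simp: eq colon_def)
  ultimately show "P \<in> associated_primes R (quotient_module R A) \<union>
      associated_primes R (quotient_module R B)"
    using P y associated_primes_quotient_iff[OF A] associated_primes_quotient_iff[OF B] by blast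
qed

text \<open>
  If \<open>y\<close> annihilates itself modulo the radical ideal \<open>A\<close>, then \<open>y \<in> A\<close>, and its annihilator is the
  whole ring.
\<close>

lemma (in cring) colon_witness_notin:
  assumes A: "radical_ideal R A" and P: "primeideal (colon R A y) R" and y: "y \<in> carrier R"
  shows "y \<notin> colon R A y"
proof
  interpret P: primeideal "colon R A y" R by fact
  assume "y \<in> colon R A y"
  then have "y \<in> A" using A y unfolding radical_ideal_def colon_def by blast
  then have "colon R A y = carrier R"
    using A ideal.I_l_closed[of A R y] unfolding radical_ideal_def colon_def by blast
  then show False using P.I_notcarr by simp
qed

text \<open>
  If \<open>P\<close> is the annihilator of \<open>y\<close>, then \<open>P y \<subseteq> A \<subseteq> Q\<close> while \<open>y \<notin> P\<close>, hence \<open>y \<notin> Q\<close>. As \<open>Q\<close> is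
  prime, \<open>P \<subseteq> Q\<close>.
\<close>

lemma (in cring) associated_primes_radical_incomparable:
  assumes A: "radical_ideal R A"
    and P: "P \<in> associated_primes R (quotient_module R A)"
    and Q: "Q \<in> associated_primes R (quotient_module R A)"
    and "Q \<subseteq> P"
  shows "Q = P"
proof -
  have iA: "ideal A R" using A by (simp add: radical_ideal_def)
  obtain y where y: "y \<in> carrier R" and Py: "P = colon R A y" and pP: "primeideal P R"
    using P associated_primes_quotient_iff[OF iA] by blast
  obtain x where Qx: "Q = colon R A x" and x: "x \<in> carrier R" and pQ: "primeideal Q R"
    using Q associated_primes_quotient_iff[OF iA] by blast
  have "y \<notin> Q"
    using colon_witness_notin[OF A _ y] pP \<open>Q \<subseteq> P\<close> unfolding Py by blast
  moreover have "A \<subseteq> Q"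
    unfolding Qx by (rule subset_colon[OF iA x])
  ultimately have "P \<subseteq> Q"
    using primeideal.I_prime[OF pQ _ y] by (auto simp: Py colon_def)
  then show ?thesis using \<open>Q \<subseteq> P\<close> by blast
qed

section \<open>Powers and products of ideals\<close>

lemma (in cring)
  assumes A: "ideal A R"
  shows ideal_power_0: "ideal_power R A 0 = carrier R"
    and ideal_power_Suc: "ideal_power R A (Suc n) = ideal_power R A n \<cdot> A"
    and ideal_power_ideal: "ideal (ideal_power R A n) R"
    and ideal_power_add: "ideal_power R A (m + n) = ideal_power R A m \<cdot> ideal_power R A n"
    and ideal_power_mult: "ideal_power R (ideal_power R A m) n = ideal_power R A (m * n)"
proof -
  interpret S: comm_monoid "ideals_set R" by (rule ideals_set_is_comm_monoid)
  have A': "A \<in> carrier (ideals_set R)" using A by (simp add: ideals_set_def)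
  show "ideal_power R A 0 = carrier R" by (simp add: ideal_power_def ideals_set_def)
  show "ideal_power R A (Suc n) = ideal_power R A n \<cdot> A"
    by (simp add: ideal_power_def) (simp add: ideals_set_def)
  show "ideal (ideal_power R A n) R"
    using S.nat_pow_closed[OF A', of n] by (simp add: ideal_power_def) (simp add: ideals_set_def)
  show "ideal_power R A (m + n) = ideal_power R A m \<cdot> ideal_power R A n"
    using S.nat_pow_mult[OF A', of m n]
    by (simp add: ideal_power_def) (simp add: ideals_set_def)
  show "ideal_power R (ideal_power R A m) n = ideal_power R A (m * n)"
    using S.nat_pow_pow[OF A', of m n] by (simp add: ideal_power_def)
qed

lemma (in cring) ideal_power_ideal_prod:
  assumes "ideal A R" "ideal B R"
  shows "ideal_power R (A \<cdot> B) n = ideal_power R A n \<cdot> ideal_power R B n"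
proof -
  interpret S: comm_monoid "ideals_set R" by (rule ideals_set_is_comm_monoid)
  have "A \<in> carrier (ideals_set R)" "B \<in> carrier (ideals_set R)"
    using assms by (simp_all add: ideals_set_def)
  from S.nat_pow_distrib[OF this, of n] show ?thesis
    by (simp add: ideal_power_def) (simp add: ideals_set_def)
qed

lemma ideal_prod_mono:
  assumes "A \<subseteq> A'" "B \<subseteq> B'"
  shows "A \<cdot>\<^bsub>R\<^esub> B \<subseteq> A' \<cdot>\<^bsub>R\<^esub> B'"
proof
  fix x assume "x \<in> A \<cdot>\<^bsub>R\<^esub> B"
  then show "x \<in> A' \<cdot>\<^bsub>R\<^esub> B'"
    by induction (use assms in \<open>auto intro: ideal_prod.intros\<close>)
qed

lemma (in cring) ideal_power_mono:
  assumes "ideal A R" "ideal B R" "A \<subseteq> B"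
  shows "ideal_power R A n \<subseteq> ideal_power R B n"
  by (induction n) (use assms in \<open>simp_all add: ideal_power_0 ideal_power_Suc ideal_prod_mono\<close>)

section \<open>Associated primes of ideals between a radical ideal and its powers\<close>

text \<open>
  If every element of \<open>F\<close> vanishes in the localisation of \<open>R/K\<close> at \<open>Q\<close>, then a single denominator
  witnesses this for all of them, namely the product of the individual ones.
\<close>

lemma (in cring) common_multiplier_outside_prime:
  assumes K: "ideal K R" and Q: "primeideal Q R" and F: "finite F" "F \<subseteq> carrier R"
    and ex: "\<And>g. g \<in> F \<Longrightarrow> \<exists>z\<in>carrier R - Q. z \<otimes> g \<in> K"
  shows "\<exists>w\<in>carrier R - Q. \<forall>g\<in>F. w \<otimes> g \<in> K"
  using F ex
proof (induction F rule: finite_induct)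
  case empty
  have "\<one> \<notin> Q"
    using ideal.one_imp_carrier[OF primeideal.axioms(1)[OF Q]] primeideal.I_notcarr[OF Q] by blast
  then show ?case by blast
next
  case (insert g F)
  then obtain w where w: "w \<in> carrier R" "w \<notin> Q" "\<forall>g\<in>F. w \<otimes> g \<in> K" by blast
  obtain z where z: "z \<in> carrier R" "z \<notin> Q" "z \<otimes> g \<in> K"
    using insert.prems(2)[of g] by blast
  have "(z \<otimes> w) \<otimes> g' \<in> K" if g': "g' \<in> insert g F" for g'
  proof (cases "g' = g")
    case True
    have "g \<in> carrier R" using insert.prems(1) by blast
    then have "(z \<otimes> w) \<otimes> g' = w \<otimes> (z \<otimes> g)" using True z(1) w(1) by (simp add: m_ac)
    then show ?thesis using ideal.I_l_closed[OF K z(3) w(1)] by (simp only:)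
  next
    case False
    then have "g' \<in> F" "g' \<in> carrier R" using g' insert.prems(1) by blast+
    then have "(z \<otimes> w) \<otimes> g' = z \<otimes> (w \<otimes> g')" using z(1) w(1) by (simp add: m_assoc)
    then show ?thesis using ideal.I_l_closed[OF K _ z(1)] w(3) \<open>g' \<in> F\<close> by metis
  qed
  moreover have "z \<otimes> w \<notin> Q" using primeideal.I_prime[OF Q z(1) w(1)] z(2) w(2) by blast
  moreover have "z \<otimes> w \<in> carrier R" using z(1) w(1) by (rule m_closed)
  ultimately show ?case by blast
qed

text \<open>
  The condition \<open>colon R K h \<subseteq> Q\<close> says that \<open>h\<close> is nonzero in \<open>R/K\<close> localised at \<open>Q\<close>. Suppose that
  multiplication by any generator of \<open>J = Idl G\<close> kills \<open>h\<close> there. Clearing denominators gives \<open>w \<notin> Q\<close>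
  with \<open>w h J \<subseteq> K\<close>. Write \<open>Q\<close> as the annihilator of \<open>x\<close> modulo \<open>J\<close>. Since \<open>J\<close> is radical,
  \<open>x \<notin> Q\<close>, so \<open>x\<close> and \<open>w\<close> are units of the localisation, and \<open>x w h\<close> is annihilated modulo \<open>K\<close> by
  precisely the elements of \<open>Q\<close>.
\<close>

lemma (in cring) colon_extend_or_associated:
  assumes G: "finite G" "G \<subseteq> carrier R" and J: "radical_ideal R (Idl G)" and K: "ideal K R"
    and Q: "Q \<in> associated_primes R (quotient_module R (Idl G))"
    and h: "h \<in> carrier R" and hQ: "colon R K h \<subseteq> Q"
  shows "Q \<in> associated_primes R (quotient_module R K) \<or> (\<exists>g\<in>G. colon R K (h \<otimes> g) \<subseteq> Q)"
proof (rule disjCI)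
  assume noext: "\<not> (\<exists>g\<in>G. colon R K (h \<otimes> g) \<subseteq> Q)"
  have iJ: "ideal (Idl G) R" using J by (simp add: radical_ideal_def)
  obtain x where x: "x \<in> carrier R" and Qx: "Q = colon R (Idl G) x" and pQ: "primeideal Q R"
    using Q associated_primes_quotient_iff[OF iJ] by blast
  have xQ: "x \<notin> Q" using colon_witness_notin[OF J _ x] pQ unfolding Qx by blast
  have "\<exists>w\<in>carrier R - Q. \<forall>g\<in>(\<otimes>) h ` G. w \<otimes> g \<in> K"
  proof (rule common_multiplier_outside_prime[OF K pQ])
    show "finite ((\<otimes>) h ` G)" "(\<otimes>) h ` G \<subseteq> carrier R" using G h by auto
    fix g assume "g \<in> (\<otimes>) h ` G"
    then obtain g' where g': "g' \<in> G" "g = h \<otimes> g'" by blast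
    with noext have "\<not> colon R K g \<subseteq> Q" by blast
    then show "\<exists>z\<in>carrier R - Q. z \<otimes> g \<in> K" unfolding colon_def by blast
  qed
  then obtain w where w: "w \<in> carrier R" "w \<notin> Q" and wG: "\<And>g. g \<in> G \<Longrightarrow> w \<otimes> (h \<otimes> g) \<in> K"
    by blast
  have wh: "w \<otimes> h \<in> carrier R" using w h by blast
  have "Idl G \<subseteq> {j \<in> carrier R. (w \<otimes> h) \<otimes> j \<in> K}"
  proof (rule genideal_minimal)
    show "ideal {j \<in> carrier R. (w \<otimes> h) \<otimes> j \<in> K} R"
      by (rule ideal.helper_max_prime[OF K cring_axioms wh])
    show "G \<subseteq> {j \<in> carrier R. (w \<otimes> h) \<otimes> j \<in> K}"
    proof
      fix g assume "g \<in> G"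
      then show "g \<in> {j \<in> carrier R. (w \<otimes> h) \<otimes> j \<in> K}"
        using wG[of g] w(1) h G(2) m_assoc[of w h g] by auto
    qed
  qed
  then have wJ: "j \<otimes> (w \<otimes> h) \<in> K" if "j \<in> Idl G" for j
    using that m_comm[of j "w \<otimes> h"] wh by auto
  let ?y = "x \<otimes> (w \<otimes> h)"
  have y: "?y \<in> carrier R" using x wh by blast
  have "Q = colon R K ?y"
  proof (intro equalityI subsetI)
    fix u assume "u \<in> Q"
    then have "u \<in> carrier R" "u \<otimes> x \<in> Idl G" by (auto simp: Qx colon_def)
    with wJ[of "u \<otimes> x"] show "u \<in> colon R K ?y"
      using m_assoc[of u x "w \<otimes> h"] x wh by (simp add: colon_def)
  next
    fix u assume u: "u \<in> colon R K ?y"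
    then have uc: "u \<in> carrier R" by (simp add: colon_def)
    have "(u \<otimes> x \<otimes> w) \<otimes> h = u \<otimes> ?y" using uc x w(1) h by (simp add: m_assoc)
    then have "u \<otimes> x \<otimes> w \<in> colon R K h" using u uc x w(1) by (simp add: colon_def)
    then have "u \<otimes> x \<otimes> w \<in> Q" using hQ by blast
    then show "u \<in> Q"
      using primeideal.I_prime[OF pQ _ w(1), of "u \<otimes> x"] primeideal.I_prime[OF pQ uc x]
        m_closed[OF uc x] w(2) xQ by blast
  qed
  then show "Q \<in> associated_primes R (quotient_module R K)"
    using associated_primes_quotient_iff[OF K] pQ y by blast
qed

text \<open>
  If \<open>Q\<close> were not associated to \<open>R/K\<close>, the preceding lemma could be iterated from \<open>h = \<one>\<close>: every
  power of \<open>J = Idl G\<close> would contain an element that is nonzero in \<open>R/K\<close> localised at \<open>Q\<close>. But the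
  \<open>N\<close>-th power of \<open>J\<close> lies in \<open>K\<close>.
\<close>

lemma (in cring) associated_primes_between_power:
  assumes G: "finite G" "G \<subseteq> carrier R" and J: "radical_ideal R (Idl G)"
    and K: "ideal K R" "ideal_power R (Idl G) N \<subseteq> K" "K \<subseteq> Idl G"
    and Q: "Q \<in> associated_primes R (quotient_module R (Idl G))"
  shows "Q \<in> associated_primes R (quotient_module R K)"
proof (rule ccontr)
  assume notin: "Q \<notin> associated_primes R (quotient_module R K)"
  have iJ: "ideal (Idl G) R" using J by (simp add: radical_ideal_def)
  obtain x where x: "x \<in> carrier R" and Qx: "Q = colon R (Idl G) x" and pQ: "primeideal Q R"
    using Q associated_primes_quotient_iff[OF iJ] by blast
  have KQ: "K \<subseteq> Q" using K(3) subset_colon[OF iJ x] unfolding Qx by blast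
  have "\<exists>h\<in>ideal_power R (Idl G) n. h \<in> carrier R \<and> colon R K h \<subseteq> Q" for n
  proof (induction n)
    case 0
    have "colon R K \<one> \<subseteq> Q" using KQ by (auto simp: colon_def)
    then show ?case unfolding ideal_power_0[OF iJ] by blast
  next
    case (Suc n)
    then obtain h where h: "h \<in> ideal_power R (Idl G) n" "h \<in> carrier R" "colon R K h \<subseteq> Q" by blast
    obtain g where g: "g \<in> G" "colon R K (h \<otimes> g) \<subseteq> Q"
      using colon_extend_or_associated[OF G J K(1) Q h(2,3)] notin by blast
    have "h \<otimes> g \<in> ideal_power R (Idl G) (Suc n)"
      using h(1) g(1) genideal_self[OF G(2)] unfolding ideal_power_Suc[OF iJ]
      by (blast intro: ideal_prod.prod)
    moreover have "h \<otimes> g \<in> carrier R" using h(2) g(1) G(2) by blast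
    ultimately show ?case using g(2) by blast
  qed
  then obtain h where "h \<in> K" "h \<in> carrier R" "colon R K h \<subseteq> Q" using K(2) by blast
  then have "\<one> \<in> Q" by (auto simp: colon_def)
  then show False
    using ideal.one_imp_carrier[OF primeideal.axioms(1)[OF pQ]] primeideal.I_notcarr[OF pQ] by blast
qed

section \<open>Products of powers of an ideal and a demotion\<close>

text \<open>
  In a Noetherian ring the hypothesis \<open>below\<close> always holds: a prime over \<open>J\<close> contains a minimal prime
  of \<open>J\<close>, and the minimal primes of \<open>J\<close> are associated to \<open>R/J\<close>.
\<close>

theorem (in cring) normally_torsion_free_demotion_prod:
  assumes I: "radical_ideal R I" and J: "radical_ideal R J"
    and G: "finite G" "G \<subseteq> carrier R" "J = Idl G"
    and below: "\<And>P. primeideal P R \<Longrightarrow> J \<subseteq> P \<Longrightarrow>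
      \<exists>Q\<in>associated_primes R (quotient_module R J). Q \<subseteq> P"
    and ntfI: "normally_torsion_free R I" and ntfJ: "normally_torsion_free R J"
    and dem: "demotion R J I"
    and sep: "\<forall>q \<in> associated_primes R (quotient_module R J) - associated_primes R (quotient_module R I).
          \<forall>p \<in> associated_primes R (quotient_module R I). \<not> q \<subseteq> p"
    and s: "s \<ge> 1"
  shows "normally_torsion_free R (ideal_power R I r \<cdot> ideal_power R J s)"
proof -
  define K where "K = ideal_power R I r \<cdot> ideal_power R J s"
  have iI: "ideal I R" and iJ: "ideal J R" and JI: "J \<subseteq> I"
    and cap: "\<And>a b. ideal_power R I a \<cdot> ideal_power R J b = ideal_power R I (a + b) \<inter> ideal_power R J b"
    using dem by (auto simp: demotion_def)
  note pI = ideal_power_ideal[OF iI] and pJ = ideal_power_ideal[OF iJ]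
  have iK: "ideal K R" unfolding K_def by (rule ideal_prod_is_ideal[OF pI pJ])
  have assIJ: "associated_primes R (quotient_module R I) \<subseteq> associated_primes R (quotient_module R J)"
  proof
    fix P assume P: "P \<in> associated_primes R (quotient_module R I)"
    then obtain y where "primeideal P R" "y \<in> carrier R" "P = colon R I y"
      using associated_primes_quotient_iff[OF iI] by blast
    moreover from this have "J \<subseteq> P"
      using JI subset_colon[OF iI] by blast
    ultimately obtain Q where Q: "Q \<in> associated_primes R (quotient_module R J)" "Q \<subseteq> P"
      using below by blast
    then have "Q \<in> associated_primes R (quotient_module R I)" using sep P by blast
    then have "Q = P" using associated_primes_radical_incomparable[OF I P] Q by blast
    then show "P \<in> associated_primes R (quotient_module R J)" using Q by simp
  qed
  have "ideal_power R J (r + s) \<subseteq> K"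
    unfolding K_def ideal_power_add[OF iJ]
    by (intro ideal_prod_mono ideal_power_mono iI iJ JI order_refl)
  moreover have "K \<subseteq> J"
  proof -
    obtain s' where "s = Suc s'" using s by (cases s) auto
    then have "ideal_power R J s \<subseteq> J"
      using ideal_prod_inter[OF pJ iJ, of s'] by (simp add: ideal_power_Suc[OF iJ])
    then show ?thesis using cap[of r s] by (auto simp: K_def)
  qed
  ultimately have assJK: "associated_primes R (quotient_module R J) \<subseteq> associated_primes R (quotient_module R K)"
    using associated_primes_between_power[of G K "r + s"] G J iK by blast
  have "associated_primes R (quotient_module R (ideal_power R K t))
      \<subseteq> associated_primes R (quotient_module R K)" if "t \<ge> 1" for t
  proof -
    have "ideal_power R K t = ideal_power R I (r * t) \<cdot> ideal_power R J (s * t)"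
      by (simp add: K_def ideal_power_ideal_prod pI pJ ideal_power_mult iI iJ)
    then have eq: "ideal_power R K t = ideal_power R I (r * t + s * t) \<inter> ideal_power R J (s * t)"
      using cap by simp
    have st: "s * t \<ge> 1" "r * t + s * t \<ge> 1" using s that by (auto simp: Suc_le_eq)
    have "associated_primes R (quotient_module R (ideal_power R K t)) \<subseteq>
        associated_primes R (quotient_module R I) \<union> associated_primes R (quotient_module R J)"
      unfolding eq using associated_primes_inter_subset[OF pI[of "r * t + s * t"] pJ[of "s * t"]]
        ntfI ntfJ st unfolding normally_torsion_free_def by blast
    then show ?thesis using assIJ assJK by blast
  qed
  then show ?thesis using iK unfolding normally_torsion_free_def K_def[symmetric] by blast
qed

section \<open>Ideals spanned by monomials\<close>

lemma cring_polynomial_ring: "cring polynomial_ring"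
  unfolding polynomial_ring_def by (rule cring_from_type_algebra)

lemma polynomial_ring_simps [simp]:
  "carrier polynomial_ring = UNIV"
  "f \<otimes>\<^bsub>polynomial_ring\<^esub> g = f * g"
  "f \<oplus>\<^bsub>polynomial_ring\<^esub> g = f + g"
  "\<zero>\<^bsub>polynomial_ring\<^esub> = 0"
  "\<one>\<^bsub>polynomial_ring\<^esub> = 1"
  by (simp_all add: polynomial_ring_def ring_of_type_algebra_def)

definition monomial_span :: "('n::finite \<Rightarrow>\<^sub>0 nat) set \<Rightarrow> (('n \<Rightarrow>\<^sub>0 nat) \<Rightarrow>\<^sub>0 'k::field) set"
  where "monomial_span U = {f. Poly_Mapping.keys f \<subseteq> U}"

lemma exponent_diff_add:
  fixes a m :: "'n \<Rightarrow>\<^sub>0 nat"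
  assumes "\<And>i. Poly_Mapping.lookup m i \<le> Poly_Mapping.lookup a i"
  shows "m + (a - m) = a"
  using assms by (intro poly_mapping_eqI) (simp add: lookup_add lookup_minus)

lemma ideal_monomial_span:
  assumes U: "\<And>a b. a \<in> U \<Longrightarrow> a + b \<in> U"
  shows "ideal (monomial_span U :: (('n::finite \<Rightarrow>\<^sub>0 nat) \<Rightarrow>\<^sub>0 'k::field) set) polynomial_ring"
proof -
  interpret R: cring "polynomial_ring :: (('n \<Rightarrow>\<^sub>0 nat) \<Rightarrow>\<^sub>0 'k) ring"
    by (rule cring_polynomial_ring)
  have mult: "f * g \<in> monomial_span U" if "f \<in> monomial_span U"
    for f g :: "('n \<Rightarrow>\<^sub>0 nat) \<Rightarrow>\<^sub>0 'k"
    using that keys_mult[of f g] U by (fastforce simp: monomial_span_def)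
  show ?thesis
  proof (rule idealI)
    show "ring (polynomial_ring :: (('n \<Rightarrow>\<^sub>0 nat) \<Rightarrow>\<^sub>0 'k) ring)" by (rule R.ring_axioms)
    show "subgroup (monomial_span U) (add_monoid (polynomial_ring :: (('n \<Rightarrow>\<^sub>0 nat) \<Rightarrow>\<^sub>0 'k) ring))"
    proof (rule R.add.subgroupI)
      show "monomial_span U \<noteq> ({} :: (('n \<Rightarrow>\<^sub>0 nat) \<Rightarrow>\<^sub>0 'k) set)"
        by (auto simp: monomial_span_def intro!: exI[of _ 0])
      fix f :: "('n \<Rightarrow>\<^sub>0 nat) \<Rightarrow>\<^sub>0 'k" assume f: "f \<in> monomial_span U"
      have "\<ominus>\<^bsub>polynomial_ring\<^esub> f = - f" by (rule R.minus_equality) simp_all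
      also have "\<dots> = f * (- 1)" by simp
      finally show "\<ominus>\<^bsub>polynomial_ring\<^esub> f \<in> monomial_span U" using mult[OF f, of "- 1"] by (simp only:)
    next
      fix f g :: "('n \<Rightarrow>\<^sub>0 nat) \<Rightarrow>\<^sub>0 'k" assume "f \<in> monomial_span U" "g \<in> monomial_span U"
      then show "f \<oplus>\<^bsub>polynomial_ring\<^esub> g \<in> monomial_span U"
        using Poly_Mapping.keys_add[of f g] by (auto simp: monomial_span_def)
    qed simp
  qed (simp_all add: mult mult.commute)
qed

lemma mem_ideal_if_monomials_mem:
  fixes A :: "(('n::finite \<Rightarrow>\<^sub>0 nat) \<Rightarrow>\<^sub>0 'k::field) set"
  assumes A: "ideal A polynomial_ring" and f: "\<And>a. a \<in> Poly_Mapping.keys f \<Longrightarrow> monomial a \<in> A"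
  shows "f \<in> A"
proof -
  interpret A: ideal A polynomial_ring by fact
  have "(\<Sum>a\<in>F. Poly_Mapping.single a (Poly_Mapping.lookup f a)) \<in> A"
    if "F \<subseteq> Poly_Mapping.keys f" for F
    using finite_subset[OF that finite_keys] that
  proof (induction F rule: finite_induct)
    case empty
    show ?case
      using additive_subgroup.zero_closed[OF A.additive_subgroup_axioms] by simp
  next
    case (insert a F)
    have "Poly_Mapping.single 0 (Poly_Mapping.lookup f a) * monomial a \<in> A"
      using A.I_l_closed[of "monomial a"] f[of a] insert.prems by simp
    then have "Poly_Mapping.single a (Poly_Mapping.lookup f a) \<in> A"
      by (simp add: monomial_def mult_single)
    then show ?case
      using insert additive_subgroup.a_closed[OF A.additive_subgroup_axioms] by simp
  qed
  moreover have "(\<Sum>a\<in>Poly_Mapping.keys f. Poly_Mapping.single a (Poly_Mapping.lookup f a)) = f"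
    by (intro poly_mapping_eqI) (simp add: lookup_sum lookup_single when_def in_keys_iff)
  ultimately show ?thesis by (metis order_refl)
qed

definition multiples :: "('n \<Rightarrow>\<^sub>0 nat) set \<Rightarrow> ('n \<Rightarrow>\<^sub>0 nat) set"
  where "multiples M = {m + b | m b. m \<in> M}"

lemma multiples_add: "a \<in> multiples M \<Longrightarrow> a + b \<in> multiples M"
  by (force simp: multiples_def add.assoc)

lemma mem_multiplesI:
  assumes "m \<in> M" "\<And>i. Poly_Mapping.lookup m i \<le> Poly_Mapping.lookup a i"
  shows "a \<in> multiples M"
  unfolding multiples_def using exponent_diff_add[OF assms(2)] assms(1)
  by (intro CollectI exI[of _ m] exI[of _ "a - m"]) auto

lemma keys_monomial [simp]: "Poly_Mapping.keys (monomial m :: _ \<Rightarrow>\<^sub>0 'k::field) = {m}"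
  by (simp add: monomial_def)

lemma monomial_add: "monomial (a + b) = monomial a * monomial b"
  by (simp add: monomial_def mult_single)

lemma Idl_monomials:
  "Idl\<^bsub>polynomial_ring\<^esub> (monomial ` M) =
    (monomial_span (multiples M) :: (('n::finite \<Rightarrow>\<^sub>0 nat) \<Rightarrow>\<^sub>0 'k::field) set)"
proof -
  interpret R: cring "polynomial_ring :: (('n \<Rightarrow>\<^sub>0 nat) \<Rightarrow>\<^sub>0 'k) ring"
    by (rule cring_polynomial_ring)
  have ideal: "ideal (Idl\<^bsub>polynomial_ring\<^esub> (monomial ` M) :: (('n \<Rightarrow>\<^sub>0 nat) \<Rightarrow>\<^sub>0 'k) set) polynomial_ring"
    by (rule R.genideal_ideal) simp
  have gen: "monomial m \<in> Idl\<^bsub>polynomial_ring\<^esub> (monomial ` M :: (('n \<Rightarrow>\<^sub>0 nat) \<Rightarrow>\<^sub>0 'k) set)"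
    if "m \<in> M" for m
    using R.genideal_self[of "monomial ` M"] that by auto
  show ?thesis
  proof
    show "Idl\<^bsub>polynomial_ring\<^esub> (monomial ` M) \<subseteq>
        (monomial_span (multiples M) :: (('n \<Rightarrow>\<^sub>0 nat) \<Rightarrow>\<^sub>0 'k) set)"
      by (intro R.genideal_minimal ideal_monomial_span multiples_add)
        (auto simp: monomial_span_def intro: mem_multiplesI)
    show "monomial_span (multiples M) \<subseteq>
        (Idl\<^bsub>polynomial_ring\<^esub> (monomial ` M) :: (('n \<Rightarrow>\<^sub>0 nat) \<Rightarrow>\<^sub>0 'k) set)"
    proof
      fix f :: "('n \<Rightarrow>\<^sub>0 nat) \<Rightarrow>\<^sub>0 'k" assume f: "f \<in> monomial_span (multiples M)"
      show "f \<in> Idl\<^bsub>polynomial_ring\<^esub> (monomial ` M)"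
      proof (rule mem_ideal_if_monomials_mem[OF ideal])
        fix a assume "a \<in> Poly_Mapping.keys f"
        then obtain m b where "m \<in> M" "a = m + b" using f by (auto simp: monomial_span_def multiples_def)
        then show "monomial a \<in> Idl\<^bsub>polynomial_ring\<^esub> (monomial ` M :: (('n \<Rightarrow>\<^sub>0 nat) \<Rightarrow>\<^sub>0 'k) set)"
          using ideal.I_r_closed[OF ideal gen, of m "monomial b"] by (simp add: monomial_add)
      qed
    qed
  qed
qed

section \<open>Monomial prime ideals\<close>

text \<open>
  The variables carry no order. Numbering them embeds the exponents into \<^typ>\<open>nat \<Rightarrow>\<^sub>0 nat\<close>, whose
  lexicographic order is linear and compatible with addition, so that leading monomials become
  available.
\<close>

lemma exponent_embedding_ordered:
  "\<exists>\<phi> :: ('n::finite \<Rightarrow>\<^sub>0 nat) \<Rightarrow> (nat \<Rightarrow>\<^sub>0 nat). inj \<phi> \<and> (\<forall>a b. \<phi> (a + b) = \<phi> a + \<phi> b)"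
proof -
  obtain e :: "'n \<Rightarrow> nat" where e: "inj e"
    using finite_imp_inj_to_nat_seg[OF finite_UNIV] by blast
  define \<phi> :: "('n \<Rightarrow>\<^sub>0 nat) \<Rightarrow> (nat \<Rightarrow>\<^sub>0 nat)"
    where "\<phi> a = (\<Sum>i\<in>UNIV. Poly_Mapping.single (e i) (Poly_Mapping.lookup a i))" for a
  have "Poly_Mapping.lookup (\<phi> a) (e i) = Poly_Mapping.lookup a i" for a i
    using e by (simp add: \<phi>_def lookup_sum lookup_single when_def inj_eq)
  then have "inj \<phi>" by (intro injI poly_mapping_eqI) metis
  moreover have "\<phi> (a + b) = \<phi> a + \<phi> b" for a b
    by (simp add: \<phi>_def lookup_add single_add sum.distrib)
  ultimately show ?thesis by blast
qed

text \<open>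
  Take \<open>a\<close> and \<open>b\<close> maximal in an order that is compatible with addition.
\<close>

lemma exponent_unique_sum:
  fixes A B :: "('n::finite \<Rightarrow>\<^sub>0 nat) set"
  assumes "finite A" "A \<noteq> {}" "finite B" "B \<noteq> {}"
  shows "\<exists>a\<in>A. \<exists>b\<in>B. \<forall>c\<in>A. \<forall>d\<in>B. c + d = a + b \<longrightarrow> c = a \<and> d = b"
proof -
  obtain \<phi> :: "('n \<Rightarrow>\<^sub>0 nat) \<Rightarrow> (nat \<Rightarrow>\<^sub>0 nat)"
    where inj: "inj \<phi>" and add: "\<And>a b. \<phi> (a + b) = \<phi> a + \<phi> b"
    using exponent_embedding_ordered by blast
  obtain a where a: "a \<in> A" "\<And>c. c \<in> A \<Longrightarrow> \<phi> c \<le> \<phi> a"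
    using Max_in[of "\<phi> ` A"] Max_ge[of "\<phi> ` A"] assms by fastforce
  obtain b where b: "b \<in> B" "\<And>d. d \<in> B \<Longrightarrow> \<phi> d \<le> \<phi> b"
    using Max_in[of "\<phi> ` B"] Max_ge[of "\<phi> ` B"] assms by fastforce
  have "c = a \<and> d = b" if c: "c \<in> A" and d: "d \<in> B" and eq: "c + d = a + b" for c d
  proof -
    have sum: "\<phi> c + \<phi> d = \<phi> a + \<phi> b" using add eq by metis
    have "\<phi> c = \<phi> a"
    proof (rule ccontr)
      assume "\<phi> c \<noteq> \<phi> a"
      then have "\<phi> c + \<phi> d < \<phi> a + \<phi> b"
        using a(2)[OF c] b(2)[OF d] by (intro add_less_le_mono) auto
      then show False using sum by simp
    qed
    then have "c = a" using inj by (simp add: inj_eq)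
    then show ?thesis using eq by simp
  qed
  then show ?thesis using a(1) b(1) by blast
qed

lemma lookup_mult_unique_sum:
  fixes f g :: "('n \<Rightarrow>\<^sub>0 nat) \<Rightarrow>\<^sub>0 'k::field"
  assumes "\<And>c d. c \<in> Poly_Mapping.keys f \<Longrightarrow> d \<in> Poly_Mapping.keys g \<Longrightarrow> c + d = a + b \<Longrightarrow> c = a"
  shows "Poly_Mapping.lookup (f * g) (a + b) = Poly_Mapping.lookup f a * Poly_Mapping.lookup g b"
proof -
  have "Poly_Mapping.lookup f c * (\<Sum>d. (Poly_Mapping.lookup g d when a + b = c + d)) =
      (Poly_Mapping.lookup f a * Poly_Mapping.lookup g b when c = a)" for c
  proof (cases "c = a")
    case True
    then show ?thesis by simp
  next
    case False
    have "(Poly_Mapping.lookup g d when a + b = c + d) = 0" if "Poly_Mapping.lookup f c \<noteq> 0" for d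
      using assms[of c d] that False by (cases "Poly_Mapping.lookup g d = 0") (auto simp: when_def in_keys_iff)
    then show ?thesis using False by (cases "Poly_Mapping.lookup f c = 0") simp_all
  qed
  then show ?thesis by (simp add: lookup_mult)
qed

text \<open>
  If neither factor lies in the span, consider in each factor only the monomials outside \<open>U\<close>, and
  take a pair of them whose product arises in one way only. Its exponent is outside \<open>U\<close> because \<open>U\<close> is
  prime; monomials in \<open>U\<close> cannot contribute to it because \<open>U\<close> is closed under adding exponents. So
  its coefficient in the product of the factors is nonzero.
\<close>

lemma primeideal_monomial_span:
  assumes up: "\<And>a b. a \<in> U \<Longrightarrow> a + b \<in> U"
    and prime: "\<And>a b. a + b \<in> U \<Longrightarrow> a \<in> U \<or> b \<in> U" and proper: "0 \<notin> U"
  shows "primeideal (monomial_span U :: (('n::finite \<Rightarrow>\<^sub>0 nat) \<Rightarrow>\<^sub>0 'k::field) set) polynomial_ring"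
proof (rule primeidealI[OF ideal_monomial_span[OF up] cring_polynomial_ring])
  have "(1 :: ('n \<Rightarrow>\<^sub>0 nat) \<Rightarrow>\<^sub>0 'k) \<notin> monomial_span U"
    using proper by (simp add: monomial_span_def)
  then show "carrier polynomial_ring \<noteq> (monomial_span U :: (('n \<Rightarrow>\<^sub>0 nat) \<Rightarrow>\<^sub>0 'k) set)"
    by auto
  fix f g :: "('n \<Rightarrow>\<^sub>0 nat) \<Rightarrow>\<^sub>0 'k"
  assume "f \<otimes>\<^bsub>polynomial_ring\<^esub> g \<in> monomial_span U"
  then have fg: "Poly_Mapping.keys (f * g) \<subseteq> U" by (simp add: monomial_span_def)
  show "f \<in> monomial_span U \<or> g \<in> monomial_span U"
  proof (rule ccontr)
    assume "\<not> ?thesis"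
    then have "Poly_Mapping.keys f - U \<noteq> {}" "Poly_Mapping.keys g - U \<noteq> {}"
      by (auto simp: monomial_span_def)
    then obtain a b where a: "a \<in> Poly_Mapping.keys f - U" and b: "b \<in> Poly_Mapping.keys g - U"
      and uniq: "\<forall>c\<in>Poly_Mapping.keys f - U. \<forall>d\<in>Poly_Mapping.keys g - U. c + d = a + b \<longrightarrow> c = a \<and> d = b"
      using exponent_unique_sum[of "Poly_Mapping.keys f - U" "Poly_Mapping.keys g - U"] by auto
    have ab: "a + b \<notin> U" using prime[of a b] a b by blast
    have "Poly_Mapping.lookup (f * g) (a + b) = Poly_Mapping.lookup f a * Poly_Mapping.lookup g b"
    proof (rule lookup_mult_unique_sum)
      fix c d assume c: "c \<in> Poly_Mapping.keys f" and d: "d \<in> Poly_Mapping.keys g" and eq: "c + d = a + b"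
      have "c \<notin> U" "d \<notin> U"
        using up[of c d] up[of d c] ab eq by (auto simp: add.commute)
      then show "c = a" using uniq c d eq by blast
    qed
    also have "\<dots> \<noteq> 0" using a b by (simp add: in_keys_iff)
    finally show False using fg ab by (auto simp: in_keys_iff)
  qed
qed

section \<open>Vertex covers and square-free monomial ideals\<close>

text \<open>
  The monomials in the ideal generated by the variables in \<open>S\<close>. For a set \<open>M\<close> of exponents,
  \<open>M \<subseteq> involving S\<close> says that \<open>S\<close> is a vertex cover of the hypergraph whose edges are the supports of
  the elements of \<open>M\<close>.
\<close>

definition involving :: "'n set \<Rightarrow> ('n \<Rightarrow>\<^sub>0 nat) set"
  where "involving S = {a. \<exists>i\<in>S. Poly_Mapping.lookup a i \<noteq> 0}"

lemma involving_add: "a \<in> involving S \<Longrightarrow> a + b \<in> involving S"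
  by (auto simp: involving_def lookup_add)

lemma primeideal_involving: "primeideal (monomial_span (involving S)) polynomial_ring"
  by (rule primeideal_monomial_span) (auto simp: involving_def lookup_add)

lemma monomial_span_multiples_subset:
  "M \<subseteq> involving S \<Longrightarrow> monomial_span (multiples M) \<subseteq> monomial_span (involving S)"
  unfolding monomial_span_def multiples_def using involving_add by fastforce

text \<open>
  A polynomial outside the ideal has a monomial \<open>a\<close> divisible by no generator. The variables missing
  from \<open>a\<close> form a vertex cover: a square-free generator fails to divide \<open>a\<close> only if it has a variable
  that \<open>a\<close> lacks. So the polynomial lies outside the prime ideal of this cover, which contains the
  monomial ideal, and its square lies outside as well.
\<close>

lemma radical_ideal_squarefree:
  assumes M: "\<And>m. m \<in> M \<Longrightarrow> squarefree_exponent m"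
  shows "radical_ideal polynomial_ring
    (monomial_span (multiples M) :: (('n::finite \<Rightarrow>\<^sub>0 nat) \<Rightarrow>\<^sub>0 'k::field) set)"
  unfolding radical_ideal_def
proof (intro conjI ballI impI)
  show "ideal (monomial_span (multiples M) :: (('n \<Rightarrow>\<^sub>0 nat) \<Rightarrow>\<^sub>0 'k) set) polynomial_ring"
    by (intro ideal_monomial_span multiples_add)
  fix f :: "('n \<Rightarrow>\<^sub>0 nat) \<Rightarrow>\<^sub>0 'k"
  assume ff: "f \<otimes>\<^bsub>polynomial_ring\<^esub> f \<in> monomial_span (multiples M)"
  show "f \<in> monomial_span (multiples M)"
  proof (rule ccontr)
    assume "f \<notin> monomial_span (multiples M)"
    then obtain a where a: "a \<in> Poly_Mapping.keys f" "a \<notin> multiples M"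
      by (auto simp: monomial_span_def)
    define S where "S = {i. Poly_Mapping.lookup a i = 0}"
    have "M \<subseteq> involving S"
    proof
      fix m assume m: "m \<in> M"
      then obtain i where i: "\<not> Poly_Mapping.lookup m i \<le> Poly_Mapping.lookup a i"
        using a(2) mem_multiplesI by blast
      moreover have "Poly_Mapping.lookup m i \<le> 1"
        using M[OF m] by (simp add: squarefree_exponent_def)
      ultimately have "Poly_Mapping.lookup a i = 0" "Poly_Mapping.lookup m i \<noteq> 0" by linarith+
      then show "m \<in> involving S" by (auto simp: involving_def S_def)
    qed
    then have "f * f \<in> monomial_span (involving S)"
      using ff monomial_span_multiples_subset by auto
    then have "f \<in> monomial_span (involving S)"
      using primeideal.I_prime[OF primeideal_involving, of f f S] by simp
    then have "a \<in> involving S" using a(1) by (auto simp: monomial_span_def)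
    then show False by (auto simp: involving_def S_def)
  qed
qed

lemma prime_contains_variable_of_monomial:
  fixes P :: "(('n::finite \<Rightarrow>\<^sub>0 nat) \<Rightarrow>\<^sub>0 'k::field) set"
  assumes P: "primeideal P polynomial_ring"
  shows "monomial m \<in> P \<Longrightarrow>
    \<exists>i. Poly_Mapping.lookup m i \<noteq> 0 \<and> monomial (Poly_Mapping.single i 1) \<in> P"
proof (induction "\<Sum>i\<in>UNIV. Poly_Mapping.lookup m i" arbitrary: m rule: less_induct)
  case less
  interpret P: primeideal P polynomial_ring by (rule P)
  have "m \<noteq> 0"
  proof
    assume "m = 0"
    then have "\<one>\<^bsub>polynomial_ring\<^esub> \<in> P" using less.prems by (simp add: monomial_def)
    then show False using P.one_imp_carrier P.I_notcarr by blast
  qed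
  then obtain i where i: "Poly_Mapping.lookup m i \<noteq> 0"
    by (metis poly_mapping_eqI lookup_zero)
  define m' where "m' = m - Poly_Mapping.single i 1"
  have m: "m = Poly_Mapping.single i 1 + m'"
    unfolding m'_def using i by (intro exponent_diff_add[symmetric]) (auto simp: lookup_single when_def Suc_le_eq)
  then have "monomial (Poly_Mapping.single i 1) * monomial m' \<in> P"
    using less.prems by (simp add: monomial_add)
  then consider "monomial (Poly_Mapping.single i 1) \<in> P" | "monomial m' \<in> P"
    using P.I_prime by auto
  then show ?case
  proof cases
    case 1
    then show ?thesis using i by blast
  next
    case 2
    have "(\<Sum>j\<in>UNIV. Poly_Mapping.lookup m' j) < (\<Sum>j\<in>UNIV. Poly_Mapping.lookup m j)"
      by (rule sum_strict_mono_ex1) (auto simp: m lookup_add lookup_single intro!: exI[of _ i])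
    from less.hyps[OF this 2] show ?thesis by (auto simp: m lookup_add)
  qed
qed

text \<open>
  The prime ideal of a minimal cover \<open>S\<close> is the annihilator of the product \<open>e\<close> of all variables outside
  \<open>S\<close>. For \<open>i \<in> S\<close>, minimality gives a generator that meets \<open>S\<close> in \<open>i\<close> only; being square-free, it
  divides \<open>x\<^sub>i e\<close>. Conversely \<open>e\<close> lies outside the prime ideal of \<open>S\<close>, which contains the monomial
  ideal, so only elements of this prime can annihilate \<open>e\<close>.
\<close>

lemma minimal_cover_associated:
  assumes M: "\<And>m. m \<in> M \<Longrightarrow> squarefree_exponent m"
    and S: "M \<subseteq> involving S" and min: "\<And>i. i \<in> S \<Longrightarrow> \<not> M \<subseteq> involving (S - {i})"
  shows "monomial_span (involving S) \<in> associated_primes polynomial_ring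
    (quotient_module polynomial_ring
      (monomial_span (multiples M) :: (('n::finite \<Rightarrow>\<^sub>0 nat) \<Rightarrow>\<^sub>0 'k::field) set))"
proof -
  let ?J = "monomial_span (multiples M) :: (('n \<Rightarrow>\<^sub>0 nat) \<Rightarrow>\<^sub>0 'k) set"
  let ?P = "monomial_span (involving S) :: (('n \<Rightarrow>\<^sub>0 nat) \<Rightarrow>\<^sub>0 'k) set"
  define e :: "'n \<Rightarrow>\<^sub>0 nat" where "e = (\<Sum>i\<in>- S. Poly_Mapping.single i 1)"
  have e: "Poly_Mapping.lookup e i = (if i \<in> S then 0 else 1)" for i
    by (simp add: e_def lookup_sum lookup_single when_def)
  have eq: "?P = colon polynomial_ring ?J (monomial e)"
  proof (intro equalityI subsetI)
    fix u assume u: "u \<in> ?P"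
    have "a + e \<in> multiples M" if a: "a \<in> Poly_Mapping.keys u" for a
    proof -
      obtain i where i: "i \<in> S" "Poly_Mapping.lookup a i \<noteq> 0"
        using u a by (auto simp: monomial_span_def involving_def)
      obtain m where m: "m \<in> M" "m \<notin> involving (S - {i})" using min[OF i(1)] by blast
      have "Poly_Mapping.lookup m j \<le> Poly_Mapping.lookup (a + e) j" for j
      proof (cases "j \<in> S - {i}")
        case True
        then show ?thesis using m(2) by (auto simp: involving_def)
      next
        case False
        then have "Poly_Mapping.lookup (a + e) j \<ge> 1"
          using i e by (auto simp: lookup_add Suc_le_eq)
        moreover have "Poly_Mapping.lookup m j \<le> 1"
          using M[OF m(1)] by (simp add: squarefree_exponent_def)
        ultimately show ?thesis by linarith
      qed
      then show ?thesis using m(1) mem_multiplesI by blast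
    qed
    then have "u * monomial e \<in> ?J"
      using keys_mult[of u "monomial e"] by (auto simp: monomial_span_def)
    then show "u \<in> colon polynomial_ring ?J (monomial e)" by (simp add: colon_def)
  next
    fix u assume "u \<in> colon polynomial_ring ?J (monomial e)"
    then have "u * monomial e \<in> ?P"
      using monomial_span_multiples_subset[OF S] by (auto simp: colon_def)
    moreover have "monomial e \<notin> ?P" using e by (auto simp: monomial_span_def involving_def)
    ultimately show "u \<in> ?P"
      using primeideal.I_prime[OF primeideal_involving, of u "monomial e" S] by auto
  qed
  have "ideal ?J polynomial_ring" by (intro ideal_monomial_span multiples_add)
  then show ?thesis
    unfolding cring.associated_primes_quotient_iff[OF cring_polynomial_ring \<open>ideal ?J polynomial_ring\<close>]
    by (intro conjI primeideal_involving bexI[of _ "monomial e"] eq) simp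
qed

text \<open>
  The variables in \<open>P\<close> cover every generator, because \<open>P\<close> is prime. Shrink this cover to a minimal one.
\<close>

lemma associated_prime_below:
  fixes P :: "(('n::finite \<Rightarrow>\<^sub>0 nat) \<Rightarrow>\<^sub>0 'k::field) set"
  assumes M: "\<And>m. m \<in> M \<Longrightarrow> squarefree_exponent m"
    and P: "primeideal P polynomial_ring" and JP: "monomial_span (multiples M) \<subseteq> P"
  shows "\<exists>Q\<in>associated_primes polynomial_ring
    (quotient_module polynomial_ring (monomial_span (multiples M))). Q \<subseteq> P"
proof -
  interpret P: primeideal P polynomial_ring by (rule P)
  define T where "T = {i. monomial (Poly_Mapping.single i 1) \<in> P}"
  have "M \<subseteq> involving T"
  proof
    fix m assume "m \<in> M"
    then have "m \<in> multiples M" by (intro mem_multiplesI) auto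
    then have "monomial m \<in> P" using JP by (auto simp: monomial_span_def)
    then show "m \<in> involving T"
      using prime_contains_variable_of_monomial[OF P] by (auto simp: T_def involving_def)
  qed
  then obtain S where S: "M \<subseteq> involving S" "S \<subseteq> T"
    and minS: "\<And>S'. M \<subseteq> involving S' \<Longrightarrow> S' \<subseteq> S \<Longrightarrow> S = S'"
    using finite_has_minimal2[of "{S. M \<subseteq> involving S}" T] by auto
  have "monomial_span (involving S) \<subseteq> P"
  proof
    fix f :: "('n \<Rightarrow>\<^sub>0 nat) \<Rightarrow>\<^sub>0 'k" assume f: "f \<in> monomial_span (involving S)"
    show "f \<in> P"
    proof (rule mem_ideal_if_monomials_mem[OF P.is_ideal])
      fix a assume "a \<in> Poly_Mapping.keys f"
      then obtain i where i: "i \<in> S" "Poly_Mapping.lookup a i \<noteq> 0"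
        using f by (auto simp: monomial_span_def involving_def)
      then have "Poly_Mapping.single i 1 + (a - Poly_Mapping.single i 1) = a"
        by (intro exponent_diff_add) (auto simp: lookup_single when_def Suc_le_eq)
      moreover have "monomial (Poly_Mapping.single i 1) * monomial (a - Poly_Mapping.single i 1) \<in> P"
        using P.I_r_closed i(1) S(2) by (auto simp: T_def)
      ultimately show "monomial a \<in> P" by (metis monomial_add)
    qed
  qed
  moreover have "\<not> M \<subseteq> involving (S - {i})" if "i \<in> S" for i
    using minS[of "S - {i}"] that by blast
  ultimately show ?thesis using minimal_cover_associated[OF M S(1)] by blast
qed

lemma finite_squarefree_exponents:
  "finite {m :: 'n::finite \<Rightarrow>\<^sub>0 nat. squarefree_exponent m}"
proof (rule inj_on_finite)
  show "inj_on Poly_Mapping.keys {m :: 'n \<Rightarrow>\<^sub>0 nat. squarefree_exponent m}"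
  proof (intro inj_onI poly_mapping_eqI)
    fix m m' :: "'n \<Rightarrow>\<^sub>0 nat" and i
    assume "m \<in> {m. squarefree_exponent m}" "m' \<in> {m. squarefree_exponent m}"
      and keys: "Poly_Mapping.keys m = Poly_Mapping.keys m'"
    then have le: "Poly_Mapping.lookup m i \<le> 1" "Poly_Mapping.lookup m' i \<le> 1"
      by (simp_all add: squarefree_exponent_def)
    have "Poly_Mapping.lookup m i = 0 \<longleftrightarrow> Poly_Mapping.lookup m' i = 0"
      using keys by (metis in_keys_iff)
    with le show "Poly_Mapping.lookup m i = Poly_Mapping.lookup m' i" by linarith
  qed
  show "Poly_Mapping.keys ` {m :: 'n \<Rightarrow>\<^sub>0 nat. squarefree_exponent m} \<subseteq> UNIV" by simp
qed simp

theorem theorem6p2: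
  fixes I J :: "(('n::finite \<Rightarrow>\<^sub>0 nat) \<Rightarrow>\<^sub>0 'k::field) set"
    and r s :: nat
  assumes "squarefree_monomial_ideal I"
    and "squarefree_monomial_ideal J"
    and "normally_torsion_free polynomial_ring I"
    and "normally_torsion_free polynomial_ring J"
    and "proper_demotion polynomial_ring J I"
    and "\<forall>q \<in> associated_primes polynomial_ring (quotient_module polynomial_ring J)
              - associated_primes polynomial_ring (quotient_module polynomial_ring I).
          \<forall>p \<in> associated_primes polynomial_ring (quotient_module polynomial_ring I). \<not> q \<subseteq> p"
    and "r \<ge> 1" and "s \<ge> 1"
  shows "normally_torsion_free polynomial_ring
           (ideal_power polynomial_ring I r \<cdot>\<^bsub>polynomial_ring\<^esub> ideal_power polynomial_ring J s)"
proof -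
  obtain M where M: "\<And>m. m \<in> M \<Longrightarrow> squarefree_exponent m"
    and I: "I = Idl\<^bsub>polynomial_ring\<^esub> (monomial ` M)"
    using assms(1) by (auto simp: squarefree_monomial_ideal_def)
  obtain N where N: "\<And>m. m \<in> N \<Longrightarrow> squarefree_exponent m"
    and J: "J = Idl\<^bsub>polynomial_ring\<^esub> (monomial ` N)"
    using assms(2) by (auto simp: squarefree_monomial_ideal_def)
  have "finite N" using N by (intro finite_subset[OF _ finite_squarefree_exponents]) auto
  show ?thesis
  proof (rule cring.normally_torsion_free_demotion_prod[OF cring_polynomial_ring _ _ _ _ J _
        assms(3,4) _ assms(6,8)])
    show "radical_ideal polynomial_ring I"
      unfolding I Idl_monomials by (rule radical_ideal_squarefree) (rule M)
    show "radical_ideal polynomial_ring J"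
      unfolding J Idl_monomials by (rule radical_ideal_squarefree) (rule N)
    show "finite (monomial ` N :: (('n \<Rightarrow>\<^sub>0 nat) \<Rightarrow>\<^sub>0 'k) set)" using \<open>finite N\<close> by simp
    show "\<exists>Q\<in>associated_primes polynomial_ring (quotient_module polynomial_ring J). Q \<subseteq> P"
      if "primeideal P polynomial_ring" "J \<subseteq> P" for P
      using associated_prime_below[OF N that(1)] that(2) unfolding J Idl_monomials by blast
    show "demotion polynomial_ring J I" using assms(5) by (simp add: proper_demotion_def)
  qed simp
qed

end
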